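(* Let $s_1\in[0,\infty)$, $t_1\in[0,1)$ and let $s_2>s_1$ be a real number. (i) If $t_2=t_1+(1-t_1)\left(1-\frac{s_1}{s_2}\right)\xi_0(s_1)$, then the inclusion $\mathfrak{A}_{s_1}^{t_1}\subset\mathfrak{A}_{s_2}^{t_2}$ holds and is sharp, in the sense that $\mathfrak{A}_{s_1}^{t_1}\not\subset\mathfrak{A}_{s_2}^{t}$ for every $t\in(t_2,1]$. (ii) If $t_2\in[0,1]$ and $\mathfrak{A}_{s_1}^{t_1}\subset\mathfrak{A}_{s_2}^{t_2}$, then $t_2\le t_1+(1-t_1)\left(1-\frac{s_1}{s_2}\right)\xi_0(s_1)$. Consequently, $(1-t_2)s_2\ge(1-t_1)s_1$. (iii) If, in addition, $s_0\in[0,s_1)$, $t_0,t_2\in[0,1)$ and the inclusions $\mathfrak{A}_{s_0}^{t_0}\subset\mathfrak{A}_{s_1}^{t_1}\subset\mathfrak{A}_{s_2}^{t_2}$ hold, then the inclusion $\mathfrak{A}_{s_0}^{t_0}\subset\mathfrak{A}_{s_2}^{t_2}$ is not sharp; that is, there exists $t\in(t_2,1]$ such that $\mathfrak{A}_{s_0}^{t_0}\subset\mathfrak{A}_{s_2}^{t}$.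
   Context: Let $\mathbb{D}=\{z\in\mathbb{C}:|z|<1\}$ and let $\mathcal{A}$ be the set of all holomorphic functions $f$ on $\mathbb{D}$ with $f(0)=0$ and $f'(0)=1$. For $s\in[0,\infty)$ and $t\in[0,1]$ define $$\mathfrak{A}_s^t:=\left\{f\in\mathcal{A}:\ \Re\left[(s-1)\frac{f(z)}{z}+f'(z)\right]\ge st\ \text{ for all } z\in\mathbb{D}\setminus\{0\}\right\}.$$ The function $\xi_0$ is defined for $s>0$ by $\xi_0(s)=\int_0^1\frac{1-x}{1+x}\,s\,x^{s-1}\,dx$ (equivalently $\xi_0(s)=2\,{}_2F_1(1,s;s+1;-1)-1$ with ${}_2F_1$ the Gauss hypergeometric function), and is extended by continuity to $s=0$ by $\xi_0(0)=1$. *)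

theory Defs
  imports "HOL-Analysis.Analysis"
begin

text \<open>
  Functions on the open unit disc are represented by total functions on \<open>\<complex>\<close>. Only the values
  on the disc matter for membership in the classes below.
\<close>

definition normalized_holomorphic :: "(complex \<Rightarrow> complex) set" where
  "normalized_holomorphic = {f. f holomorphic_on ball 0 1 \<and> f 0 = 0 \<and> deriv f 0 = 1}"

text \<open>Intended for \<open>s \<ge> 0\<close> and \<open>0 \<le> t \<le> 1\<close>.\<close>

definition frakA :: "real \<Rightarrow> real \<Rightarrow> (complex \<Rightarrow> complex) set" where
  "frakA s t = {f \<in> normalized_holomorphic.
     \<forall>z \<in> ball 0 1 - {0}. Re ((of_real s - 1) * (f z / z) + deriv f z) \<ge> s * t}"

text \<open>
  Intended for \<open>s \<ge> 0\<close>. The value at \<open>0\<close> is the limit as \<open>s\<close> tends to \<open>0\<close> from the right; the integral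
  itself would be \<open>0\<close> there. For \<open>0 < s < 1\<close> the integrand is unbounded near \<open>x = 0\<close> but integrable.
\<close>

definition xi0 :: "real \<Rightarrow> real" where
  "xi0 s = (if s = 0 then 1
            else integral {0..1} (\<lambda>x. (1 - x) / (1 + x) * s * x powr (s - 1)))"

end

theory Submission
  imports Defs "HOL-Complex_Analysis.Complex_Analysis"
begin

text \<open>
  Write \<open>f(z) = z h(z)\<close> with \<open>h(0) = 1\<close>. The expression that defines the class with parameter \<open>s\<close>
  becomes \<open>s h + z h'\<close>, and this equals \<open>(s\<^sub>2 - s\<^sub>1) h + (s\<^sub>1 h + z h')\<close> at \<open>s = s\<^sub>2\<close>. An inclusion between
  two classes is therefore a question about how small \<open>Re h\<close> can be when \<open>Re (s h + z h') \<ge> s t\<close>.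

  For \<open>s > 0\<close> put \<open>p = (s h + z h') / s\<close>. Since the derivative of \<open>x\<^sup>s h(xz)\<close> in \<open>x\<close> is
  \<open>s x\<^sup>s\<^sup>-\<^sup>1 p(xz)\<close>, the value \<open>h(z)\<close> is the mean of the values \<open>p(xz)\<close>, \<open>0 \<le> x \<le> 1\<close>, with weight
  \<open>s x\<^sup>s\<^sup>-\<^sup>1\<close>. Harnack's inequality gives \<open>Re p(w) \<ge> t + (1 - t) (1 - |w|) / (1 + |w|)\<close>, and averaging
  this bound gives \<open>Re h \<ge> t + (1 - t) \<xi>\<^sub>0(s)\<close>, because \<open>\<xi>\<^sub>0(s)\<close> is by definition the mean of
  \<open>(1 - x) / (1 + x)\<close> (\<open>Re_quotient_ge\<close>). For \<open>s = 0\<close> the real part of \<open>h\<close> is nondecreasing along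
  radii, so it is at least \<open>h(0) = 1 = \<xi>\<^sub>0(0)\<close>. The inclusion in part (i) follows.

  The bounds \<open>Re p \<ge> t\<close> and \<open>Re h \<ge> t + (1 - t) \<xi>\<^sub>0(s)\<close> become equalities in the limit \<open>z \<rightarrow> 1\<close> along the radius for the function \<open>h\<close> with
  \<open>p(z) = t + (1 - t) (1 - z) / (1 + z)\<close>. This gives sharpness and part (ii) for \<open>s\<^sub>1 > 0\<close>
  (\<open>frakA_inclusion_bound\<close>). For \<open>s\<^sub>1 = 0\<close> the sharp value of \<open>t\<^sub>2\<close> is \<open>1\<close>, which is the largest
  value considered.

  For part (iii), let \<open>c(s, r)\<close> be the factor \<open>1 - (1 - s / r) \<xi>\<^sub>0(s)\<close>, by which \<open>1 - t\<close> is multiplied in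
  the sharp inclusion from \<open>s\<close> to \<open>r\<close>. If \<open>s\<^sub>0 = 0\<close>, the direct inclusion holds with the value \<open>1 > t\<^sub>2\<close>.
  If \<open>s\<^sub>0 > 0\<close>, it suffices by (ii) that
  \<open>c(s\<^sub>0, s\<^sub>2) < c(s\<^sub>0, s\<^sub>1) c(s\<^sub>1, s\<^sub>2)\<close>, and clearing denominators turns this into the statement that
  \<open>s \<xi>\<^sub>0(s) / (1 - \<xi>\<^sub>0(s))\<close> is strictly decreasing. Integration by parts shows that this quotient is
  the mean of the decreasing function \<open>1 / (1 + x)\<close> on \<open>[0, 1]\<close> with weight \<open>x\<^sup>s / (1 + x)\<close>. A larger
  \<open>s\<close> moves the weight to the right, so the mean drops.
\<close>

section \<open>The function \<open>\<xi>\<^sub>0\<close>\<close>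

lemma continuous_on_powr_unit:
  fixes s :: real
  assumes "s > 0"
  shows "continuous_on {0..1} (\<lambda>x::real. x powr s)"
  by (rule continuous_on_powr'[OF continuous_on_id continuous_on_const]) (use assms in auto)

lemma has_integral_powr_weight:
  fixes s :: real
  assumes "s > 0"
  shows "((\<lambda>x. s * x powr (s - 1)) has_integral 1) {0..1}"
proof -
  have "((\<lambda>x. s * x powr (s - 1)) has_integral (1 powr s - 0 powr s)) {0..1}"
  proof (rule fundamental_theorem_of_calculus_interior)
    show "continuous_on {0..1} (\<lambda>x::real. x powr s)"
      by (rule continuous_on_powr_unit[OF assms])
    show "((\<lambda>x. x powr s) has_vector_derivative s * x powr (s - 1)) (at x)"
      if "x \<in> {0<..<1}" for x
      using that
      by (auto intro!: derivative_eq_intros simp flip: has_real_derivative_iff_has_vector_derivative)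
  qed simp
  then show ?thesis by simp
qed

lemma continuous_on_powr_div:
  fixes s :: real
  assumes "s > 0"
  shows "continuous_on {0..1} (\<lambda>x::real. x powr s / (1 + x) ^ n)"
  by (intro continuous_on_divide continuous_on_powr_unit assms) (auto intro!: continuous_on_power continuous_on_add)

text \<open>
  Integrating \<open>s x\<^sup>s\<^sup>-\<^sup>1\<close> and differentiating \<open>(1 - x) / (1 + x)\<close>; the boundary terms vanish at both
  ends. The new integrand is continuous also for \<open>s < 1\<close>, so this proves integrability as well.
\<close>

lemma has_integral_xi0_by_parts:
  fixes s :: real
  assumes "s > 0"
  shows "((\<lambda>x. (1 - x) / (1 + x) * s * x powr (s - 1)) has_integral
           2 * integral {0..1} (\<lambda>x. x powr s / (1 + x)^2)) {0..1}"
proof -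
  let ?u = "\<lambda>x::real. x powr s * ((1 - x) / (1 + x))"
  let ?u' = "\<lambda>x::real. (1 - x) / (1 + x) * s * x powr (s - 1) - 2 * (x powr s / (1 + x)^2)"
  have "(?u' has_integral (?u 1 - ?u 0)) {0..1}"
  proof (rule fundamental_theorem_of_calculus_interior)
    show "continuous_on {0..1} ?u"
      by (intro continuous_on_mult continuous_on_powr_unit assms continuous_on_divide) (auto intro!: continuous_intros)
    show "(?u has_vector_derivative ?u' x) (at x)" if "x \<in> {0<..<1}" for x
    proof -
      have "(?u has_real_derivative
              x powr s * ((- 1 * (1 + x) - (1 - x)) / ((1 + x) * (1 + x)))
              + s * x powr (s - 1) * ((1 - x) / (1 + x))) (at x)"
      proof -
        have "((\<lambda>x. x powr s) has_real_derivative s * x powr (s - 1)) (at x)"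
          using that by (auto intro!: derivative_eq_intros)
        moreover have "((\<lambda>x. (1 - x) / (1 + x)) has_real_derivative
            (- 1 * (1 + x) - (1 - x)) / ((1 + x) * (1 + x))) (at x)"
          using that by (auto intro!: derivative_eq_intros)
        ultimately show ?thesis by (rule DERIV_mult'[THEN DERIV_cong]) simp
      qed
      also have "x powr s * ((- 1 * (1 + x) - (1 - x)) / ((1 + x) * (1 + x)))
              + s * x powr (s - 1) * ((1 - x) / (1 + x)) = ?u' x"
        by (simp add: power2_eq_square mult_ac)
      finally show ?thesis
        by (simp add: has_real_derivative_iff_has_vector_derivative)
    qed
  qed simp
  then have 1: "(?u' has_integral 0) {0..1}" by simp
  have 2: "((\<lambda>x. 2 * (x powr s / (1 + x)^2)) has_integral
          2 * integral {0..1} (\<lambda>x. x powr s / (1 + x)^2)) {0..1}"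
    using integrable_continuous_real[OF continuous_on_powr_div[OF assms, of 2]]
    by (intro has_integral_mult_right integrable_integral)
  from has_integral_add[OF 1 2] show ?thesis by simp
qed

lemma xi0_eq: "s > 0 \<Longrightarrow> xi0 s = 2 * integral {0..1} (\<lambda>x. x powr s / (1 + x)^2)"
  using has_integral_xi0_by_parts[of s] by (simp add: xi0_def integral_unique)

lemma has_integral_xi0:
  "s > 0 \<Longrightarrow> ((\<lambda>x. (1 - x) / (1 + x) * s * x powr (s - 1)) has_integral xi0 s) {0..1}"
  using has_integral_xi0_by_parts[of s] by (simp add: xi0_eq)

lemma one_minus_xi0_eq:
  assumes "s > 0"
  shows "1 - xi0 s = 2 * s * integral {0..1} (\<lambda>x. x powr s / (1 + x))"
proof -
  have "((\<lambda>x. s * x powr (s - 1) - (1 - x) / (1 + x) * s * x powr (s - 1)) has_integral 1 - xi0 s) {0..1}"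
    using has_integral_diff[OF has_integral_powr_weight[OF assms] has_integral_xi0[OF assms]] .
  then have "((\<lambda>x. 2 * s * (x powr s / (1 + x))) has_integral 1 - xi0 s) {0..1}"
  proof (rule has_integral_eq[rotated])
    fix x :: real assume x: "x \<in> {0..1}"
    have "s * x powr (s - 1) - (1 - x) / (1 + x) * s * x powr (s - 1)
          = 2 * s * (x * x powr (s - 1)) / (1 + x)"
      using x by (simp add: field_simps)
    also have "x * x powr (s - 1) = x powr s"
      using x by (cases "x = 0") (auto simp: powr_mult_base)
    finally show "s * x powr (s - 1) - (1 - x) / (1 + x) * s * x powr (s - 1)
          = 2 * s * (x powr s / (1 + x))" by simp
  qed
  then have "1 - xi0 s = integral {0..1} (\<lambda>x. 2 * s * (x powr s / (1 + x)))"
    by (rule integral_unique[symmetric])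
  also have "\<dots> = 2 * s * integral {0..1} (\<lambda>x. x powr s / (1 + x))"
    by (rule integral_mult_right)
  finally show ?thesis .
qed

lemma xi0_le_1: "0 \<le> s \<Longrightarrow> xi0 s \<le> 1"
proof (cases "s = 0")
  case False
  assume "0 \<le> s"
  then have s: "s > 0" using False by simp
  have "0 \<le> integral {0..1} (\<lambda>x. x powr s / (1 + x))"
    by (intro integral_nonneg integrable_continuous_real)
       (use continuous_on_powr_div[OF s, of 1] in auto)
  then show ?thesis using one_minus_xi0_eq[OF s] s by (smt (verit) mult_nonneg_nonneg)
qed (simp add: xi0_def)

lemma integral_pos:
  fixes f :: "real \<Rightarrow> real"
  assumes "continuous_on {a..b} f" "a < b" "\<And>x. x \<in> {a..b} \<Longrightarrow> 0 \<le> f x"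
    and "c \<in> {a..b}" "f c > 0"
  shows "integral {a..b} f > 0"
proof -
  have "integral {a..b} f \<ge> 0"
    using assms by (intro integral_nonneg integrable_continuous_real) auto
  moreover have "integral {a..b} f \<noteq> 0"
    using integral_eq_0_iff[OF assms(1,2,3)] assms(4,5) by force
  ultimately show ?thesis by simp
qed

text \<open>
  \<open>B a / J a\<close> is the mean of \<open>1 / (1 + x)\<close> with weight \<open>x\<^sup>a / (1 + x)\<close>. The proof is Chebyshev's
  argument with a single integral: \<open>c\<close> is the point where \<open>1 / (1 + x)\<close> takes its mean value
  for the exponent \<open>r\<close>, and both factors of
  \<open>(c\<^sup>r\<^sup>-\<^sup>s - x\<^sup>r\<^sup>-\<^sup>s) (c - x)\<close> change sign at \<open>x = c\<close> only. Integrating this product against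
  a positive weight leaves only the terms with exponent \<open>s\<close>, because those with exponent \<open>r\<close> cancel by
  the choice of \<open>c\<close>.
\<close>

lemma powr_integral_ratio_strict_decreasing:
  fixes s r :: real
  assumes "0 < s" "s < r"
  defines "B \<equiv> \<lambda>a. integral {0..1} (\<lambda>x::real. x powr a / (1 + x)^2)"
    and "J \<equiv> \<lambda>a. integral {0..1} (\<lambda>x::real. x powr a / (1 + x))"
  shows "B r * J s < B s * J r"
proof -
  have cB: "continuous_on {0..1} (\<lambda>x::real. x powr a / (1 + x)^2)" if "a > 0" for a
    using continuous_on_powr_div[OF that, of 2] .
  have cJ: "continuous_on {0..1} (\<lambda>x::real. x powr a / (1 + x))" if "a > 0" for a
    using continuous_on_powr_div[OF that, of 1] by simp
  have IB: "((\<lambda>x::real. x powr a / (1 + x)^2) has_integral B a) {0..1}" if "a > 0" for a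
    unfolding B_def by (intro integrable_integral integrable_continuous_real cB that)
  have IJ: "((\<lambda>x::real. x powr a / (1 + x)) has_integral J a) {0..1}" if "a > 0" for a
    unfolding J_def by (intro integrable_integral integrable_continuous_real cJ that)
  have r: "r > 0" using assms by simp
  have Bpos: "B r > 0" unfolding B_def
    by (rule integral_pos[where c = 1]) (use cB[OF r] in auto)
  have BJ: "B r \<le> J r"
    by (rule has_integral_le[OF IB[OF r] IJ[OF r]])
       (auto intro!: divide_left_mono simp: power2_eq_square)
  define c where "c = J r / B r - 1"
  have c: "c \<ge> 0" using BJ Bpos by (simp add: c_def)
  have cB_eq: "J r = (1 + c) * B r" using Bpos by (simp add: c_def)
  define g where "g = (\<lambda>x::real. (c powr (r - s) * x powr s - x powr r) * ((c - x) / (1 + x)^2))"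
  have g_eq: "g x = (c powr (r - s) * ((1 + c) * (x powr s / (1 + x)^2) - x powr s / (1 + x))
       - ((1 + c) * (x powr r / (1 + x)^2) - x powr r / (1 + x)))" if "x \<in> {0..1}" for x
  proof -
    have "1 + x \<noteq> 0" using that by auto
    then have *: "y / (1 + x) = y * (1 + x) / (1 + x)^2" for y
      by (simp add: power2_eq_square)
    show ?thesis unfolding g_def *[of "x powr s"] *[of "x powr r"]
      by (simp add: add_divide_distrib diff_divide_distrib algebra_simps)
  qed
  have "((\<lambda>x::real. c powr (r - s) * ((1 + c) * (x powr s / (1 + x)^2) - x powr s / (1 + x))
       - ((1 + c) * (x powr r / (1 + x)^2) - x powr r / (1 + x))) has_integral
       c powr (r - s) * ((1 + c) * B s - J s) - ((1 + c) * B r - J r)) {0..1}"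
    by (intro has_integral_diff has_integral_mult_right IB IJ r assms)
  then have "(g has_integral
       c powr (r - s) * ((1 + c) * B s - J s) - ((1 + c) * B r - J r)) {0..1}"
    by (rule has_integral_eq[rotated]) (simp add: g_eq)
  then have g_int: "integral {0..1} g = c powr (r - s) * ((1 + c) * B s - J s)"
    by (simp add: integral_unique cB_eq)
  have g_factor: "g x = x powr s * ((c powr (r - s) - x powr (r - s)) * (c - x)) / (1 + x)^2"
    for x
  proof -
    have "x powr r = x powr s * x powr (r - s)" by (simp flip: powr_add)
    then have "g x = (c powr (r - s) * x powr s - x powr s * x powr (r - s)) * ((c - x) / (1 + x)^2)"
      by (simp add: g_def)
    also have "\<dots> = x powr s * ((c powr (r - s) - x powr (r - s)) * (c - x)) / (1 + x)^2"
      unfolding times_divide_eq_right by (rule arg_cong[where f = "\<lambda>u. u / (1 + x)^2"]) algebra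
    finally show ?thesis .
  qed
  have sgn: "0 \<le> (c powr (r - s) - x powr (r - s)) * (c - x)" if "x \<ge> 0" for x
  proof (cases "x \<le> c")
    case True
    then have "x powr (r - s) \<le> c powr (r - s)" using that assms(2) by (intro powr_mono2) auto
    then show ?thesis using True by simp
  next
    case False
    then have "c powr (r - s) \<le> x powr (r - s)" using c assms(2) by (intro powr_mono2) auto
    then show ?thesis using False by (intro mult_nonpos_nonpos) auto
  qed
  have sgn': "0 < (c powr (r - s) - x powr (r - s)) * (c - x)" if "x > 0" "x \<noteq> c" for x
  proof (cases "x < c")
    case True
    then have "x powr (r - s) < c powr (r - s)" using that assms(2) by (intro powr_less_mono2) auto
    then show ?thesis using True by simp
  next
    case False
    then have "c powr (r - s) < x powr (r - s)" using that c assms(2) by (intro powr_less_mono2) auto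
    then show ?thesis using False that by (intro mult_neg_neg) auto
  qed
  \<comment> \<open>The integrand vanishes at \<open>c\<close>, so positivity of the integral is read off at a point other than \<open>c\<close>.\<close>
  define y :: real where "y = (if c = 1 then 1/2 else 1)"
  have y: "y \<in> {0..1}" "y > 0" "y \<noteq> c" by (auto simp: y_def)
  have "integral {0..1} g > 0"
  proof (rule integral_pos[where c = y])
    show "continuous_on {0..1} g"
      unfolding g_def
      by (intro continuous_on_mult continuous_on_diff continuous_on_const continuous_on_powr_unit
                assms r continuous_on_divide continuous_on_id continuous_on_power continuous_on_add) auto
    show "0 \<le> g x" if "x \<in> {0..1}" for x
      unfolding g_factor using that
      by (intro divide_nonneg_nonneg mult_nonneg_nonneg[OF _ sgn]) auto
    show "g y > 0"
      unfolding g_factor using y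
      by (intro divide_pos_pos mult_pos_pos[OF _ sgn']) auto
  qed (use y in auto)
  then have "(1 + c) * B s - J s > 0"
    unfolding g_int by (metis less_le_trans mult_less_0_iff not_less powr_ge_zero zero_less_mult_iff order.asym)
  then have "J s * B r < (1 + c) * B s * B r" using Bpos by simp
  then show ?thesis by (simp add: cB_eq algebra_simps)
qed

text \<open>
  The integral formulas for \<open>\<xi>\<^sub>0\<close> and \<open>1 - \<xi>\<^sub>0\<close> turn \<open>s \<xi>\<^sub>0(s) / (1 - \<xi>\<^sub>0(s))\<close> into the quotient whose strict
  decrease is proved above.
\<close>

lemma xi0_ratio_strict_decreasing:
  assumes "0 < s" "s < r"
  shows "r * xi0 r * (1 - xi0 s) < s * xi0 s * (1 - xi0 r)"
proof -
  have r: "r > 0" using assms by simp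
  define B where "B = (\<lambda>a. integral {0..1} (\<lambda>x::real. x powr a / (1 + x)^2))"
  define J where "J = (\<lambda>a. integral {0..1} (\<lambda>x::real. x powr a / (1 + x)))"
  have "(4 * r * s) * (B r * J s) < (4 * r * s) * (B s * J r)"
    using powr_integral_ratio_strict_decreasing[OF assms] assms r
    unfolding B_def J_def by (intro mult_strict_left_mono) auto
  moreover have "r * xi0 r * (1 - xi0 s) = (4 * r * s) * (B r * J s)"
    unfolding xi0_eq[OF r] one_minus_xi0_eq[OF assms(1)] B_def J_def by simp
  moreover have "s * xi0 s * (1 - xi0 r) = (4 * r * s) * (B s * J r)"
    unfolding xi0_eq[OF assms(1)] one_minus_xi0_eq[OF r] B_def J_def by simp
  ultimately show ?thesis by presburger
qed

section \<open>Harnack's inequality\<close>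

lemma Re_pos_iff_Cayley: "Re q > 0 \<longleftrightarrow> norm (1 - q) < norm (1 + q)"
proof -
  have "norm (1 - q) < norm (1 + q) \<longleftrightarrow> (norm (1 - q))\<^sup>2 < (norm (1 + q))\<^sup>2"
    by (smt (verit) norm_ge_zero power2_less_imp_less power_strict_mono zero_less_numeral)
  also have "\<dots> \<longleftrightarrow> Re q > 0" by (simp add: cmod_power2) (simp add: power2_eq_square algebra_simps)
  finally show ?thesis ..
qed

text \<open>
  With \<open>w = (1 - q) / (1 + q)\<close> one has \<open>1 + q = 2 / (1 + w)\<close>, which is bounded below by
  \<open>2 / (1 + \<rho>)\<close> in norm, and \<open>4 Re q = |1 + q|\<^sup>2 - |1 - q|\<^sup>2\<close>.
\<close>

lemma Re_ge_of_Cayley_le: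
  assumes "norm (1 - q) \<le> \<rho> * norm (1 + q)" "0 \<le> \<rho>" "\<rho> < 1"
  shows "Re q \<ge> (1 - \<rho>) / (1 + \<rho>)"
proof -
  define w where "w = (1 - q) / (1 + q)"
  have q: "1 + q \<noteq> 0" using assms by (auto simp: add_eq_0_iff)
  have w: "norm w \<le> \<rho>" using assms q by (simp add: w_def norm_divide divide_simps)
  have "(1 + q) * (1 + w) = 2" using q by (simp add: w_def field_simps)
  then have n: "norm (1 + q) * norm (1 + w) = 2"
    by (metis norm_mult norm_numeral)
  have "norm (1 + w) \<le> 1 + \<rho>" using w norm_triangle_ineq[of 1 w] by simp
  then have n': "2 \<le> norm (1 + q) * (1 + \<rho>)"
    using n by (metis mult_left_mono norm_ge_zero)
  define N where "N = norm (1 + q)"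
  have N: "N \<ge> 2 / (1 + \<rho>)" using n' assms by (simp add: N_def field_simps)
  have "(norm (1 - q))\<^sup>2 \<le> (\<rho> * N)\<^sup>2" using assms unfolding N_def by (intro power_mono) auto
  moreover have "4 * Re q = N\<^sup>2 - (norm (1 - q))\<^sup>2"
    unfolding N_def cmod_power2 by (simp add: power2_eq_square algebra_simps)
  ultimately have "4 * Re q \<ge> (1 - \<rho>\<^sup>2) * N\<^sup>2" by (simp add: algebra_simps)
  moreover have "(1 - \<rho>\<^sup>2) * N\<^sup>2 \<ge> (1 - \<rho>\<^sup>2) * (2 / (1 + \<rho>))\<^sup>2"
    using assms N by (intro mult_left_mono power_mono) (auto simp: power_le_one)
  moreover have "(1 - \<rho>\<^sup>2) * (2 / (1 + \<rho>))\<^sup>2 = 4 * ((1 - \<rho>) / (1 + \<rho>))"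
    using assms by (simp add: power2_eq_square divide_simps) (simp add: algebra_simps)
  ultimately show ?thesis by linarith
qed

text \<open>
  The Schwarz lemma, applied to the Cayley transform \<open>(1 - q) / (1 + q)\<close>, which vanishes at the origin.
\<close>

lemma Harnack_of_Re_pos:
  assumes holo: "q holomorphic_on ball 0 1" and q0: "q 0 = 1"
    and pos: "\<And>z. norm z < 1 \<Longrightarrow> Re (q z) > 0" and z: "norm z < 1"
  shows "Re (q z) \<ge> (1 - norm z) / (1 + norm z)"
proof (rule Re_ge_of_Cayley_le)
  have nz: "1 + q u \<noteq> 0" if "norm u < 1" for u
    using pos[OF that] by (auto simp: add_eq_0_iff complex_eq_iff)
  define w where "w = (\<lambda>u. (1 - q u) / (1 + q u))"
  have "norm (w z) \<le> norm z"
  proof (rule Schwarz_Lemma(1))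
    show "w holomorphic_on ball 0 1"
      unfolding w_def using nz by (intro holomorphic_intros holo) auto
    show "norm (w u) < 1" if "norm u < 1" for u
      using pos[OF that] nz[OF that] unfolding Re_pos_iff_Cayley w_def
      by (simp add: norm_divide)
  qed (use z q0 in \<open>auto simp: w_def\<close>)
  then show "norm (1 - q z) \<le> norm z * norm (1 + q z)"
    using nz[OF z] by (simp add: w_def norm_divide divide_simps)
qed (use z in auto)

text \<open>
  The positive case needs a strict bound on the real part. For every \<open>t' < t\<close> the normalisation
  \<open>(p - t') / (1 - t')\<close> has one, and the estimate passes to the limit \<open>t' \<rightarrow> t\<close>.
\<close>

lemma Harnack_of_Re_ge:
  assumes holo: "p holomorphic_on ball 0 1" and p0: "p 0 = 1" and t: "t < 1"
    and ge: "\<And>z. norm z < 1 \<Longrightarrow> Re (p z) \<ge> t" and z: "norm z < 1"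
  shows "Re (p z) \<ge> t + (1 - t) * ((1 - norm z) / (1 + norm z))"
proof -
  define k where "k = (1 - norm z) / (1 + norm z)"
  have below: "Re (p z) \<ge> t' + (1 - t') * k" if "t' < t" for t'
  proof -
    define q where "q = (\<lambda>u. (p u - of_real t') / of_real (1 - t'))"
    have t': "1 - t' > 0" using t that by simp
    have Re_q: "Re (q u) = (Re (p u) - t') / (1 - t')" for u
      unfolding q_def Re_divide_of_real by simp
    have "Re (q z) \<ge> k" unfolding k_def
    proof (rule Harnack_of_Re_pos[OF _ _ _ z])
      show "q holomorphic_on ball 0 1"
        unfolding q_def using t' by (intro holomorphic_intros holo) (auto simp del: of_real_diff)
      show "q 0 = 1" using t' p0 by (simp add: q_def complex_eq_iff)
      show "Re (q u) > 0" if "norm u < 1" for u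
        using ge[OF that] \<open>t' < t\<close> t' unfolding Re_q by (intro divide_pos_pos) auto
    qed
    then show ?thesis using t' by (simp add: Re_q field_simps)
  qed
  have "((\<lambda>t'. t' + (1 - t') * k) \<longlongrightarrow> t + (1 - t) * k) (at_left t)"
    by (intro tendsto_intros)
  then show ?thesis unfolding k_def[symmetric]
    by (rule tendsto_upperbound)
       (auto intro!: eventually_at_leftI[of "t - 1"] below simp: trivial_limit_at_left_real)
qed

section \<open>The classes in terms of \<open>f(z)/z\<close>\<close>

lemma frakA_mult_iff:
  assumes h: "h holomorphic_on ball 0 1" and h0: "h 0 = 1"
    and f: "\<And>z. norm z < 1 \<Longrightarrow> f z = z * h z"
  shows "f \<in> frakA s t \<longleftrightarrow>
    (\<forall>z \<in> ball 0 1 - {0}. Re (of_real s * h z + z * deriv h z) \<ge> s * t)"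
proof -
  have df: "(f has_field_derivative h z + z * deriv h z) (at z)" if "norm z < 1" for z
  proof -
    have "((\<lambda>z. z * h z) has_field_derivative h z + z * deriv h z) (at z)"
      using holomorphic_derivI[OF h open_ball, of z] that
      by (auto intro!: derivative_eq_intros)
    then show ?thesis
      by (rule DERIV_cong_ev[OF refl _ refl, THEN iffD1, rotated])
         (use that f in \<open>auto intro!: eventually_nhds_in_open[of "ball 0 1", THEN eventually_mono]\<close>)
  qed
  have "f holomorphic_on ball 0 1"
    using df unfolding holomorphic_on_open[OF open_ball] by (metis mem_ball_0)
  moreover have "deriv f 0 = 1" using df[of 0] h0 by (simp add: DERIV_imp_deriv)
  ultimately have "f \<in> normalized_holomorphic"
    using f[of 0] by (simp add: normalized_holomorphic_def)
  moreover have "(of_real s - 1) * (f z / z) + deriv f z = of_real s * h z + z * deriv h z"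
    if "z \<in> ball 0 1 - {0}" for z
    using that f[of z] DERIV_imp_deriv[OF df[of z]] by (simp add: algebra_simps)
  ultimately show ?thesis unfolding frakA_def mem_Collect_eq by simp
qed

lemma frakA_quotient:
  assumes "f \<in> frakA s t"
  obtains h where "h holomorphic_on ball 0 1" "h 0 = 1" "\<And>z. norm z < 1 \<Longrightarrow> f z = z * h z"
proof -
  have f: "f holomorphic_on ball 0 1" "f 0 = 0" "deriv f 0 = 1"
    using assms by (auto simp: frakA_def normalized_holomorphic_def)
  show thesis
    by (rule Schwarz3[OF f(1,2)]) (use that f(3) in auto)
qed

section \<open>Averages along radii\<close>

lemma norm_radial_less_1:
  fixes z :: complex
  assumes "norm z < 1" "x \<in> {0..1}"
  shows "norm (of_real x * z) < 1"
proof -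
  have "\<bar>x\<bar> * norm z \<le> norm z" using assms by (auto intro: mult_left_le_one_le)
  then show ?thesis using assms by (simp add: norm_mult)
qed

lemma continuous_on_radial:
  assumes h: "h holomorphic_on ball 0 1" and z: "norm z < 1"
  shows "continuous_on {0..1} (\<lambda>x. h (of_real x * z))"
  by (rule continuous_on_compose2[OF holomorphic_on_imp_continuous_on[OF h]])
     (use norm_radial_less_1[OF z] in \<open>auto intro!: continuous_intros\<close>)

lemma has_real_derivative_Re_radial:
  assumes h: "h holomorphic_on ball 0 1" and z: "norm z < 1" and x: "x \<in> {0<..<1}"
  shows "((\<lambda>x. Re (h (of_real x * z))) has_real_derivative Re (z * deriv h (of_real x * z))) (at x)"
proof -
  have "(h has_field_derivative deriv h (of_real x * z)) (at (of_real x * z))"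
    by (rule holomorphic_derivI[OF h]) (use norm_radial_less_1[OF z, of x] x in auto)
  moreover have "((\<lambda>x. of_real x * z) has_vector_derivative z) (at x)"
    by (auto intro!: derivative_eq_intros)
  ultimately have "((\<lambda>x. h (of_real x * z)) has_vector_derivative z * deriv h (of_real x * z)) (at x)"
    using field_vector_diff_chain_at[of "\<lambda>x. of_real x * z" z x h] by (simp add: o_def)
  then have "((\<lambda>x. Re (h (of_real x * z))) has_vector_derivative Re (z * deriv h (of_real x * z))) (at x)"
    by (rule bounded_linear.has_vector_derivative[OF bounded_linear_Re])
  then show ?thesis by (simp add: has_real_derivative_iff_has_vector_derivative)
qed

text \<open>
  The fundamental theorem of calculus for \<open>x\<^sup>s Re h(xz)\<close>. The factor \<open>x\<^sup>s\<close> is an integrating factor for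
  \<open>s h + z h'\<close>, and it removes the contribution of the endpoint \<open>0\<close>.
\<close>

lemma has_integral_radial:
  assumes h: "h holomorphic_on ball 0 1" and s: "s > 0" and z: "norm z < 1"
  shows "((\<lambda>x. x powr (s - 1) * Re (of_real s * h (of_real x * z)
            + of_real x * z * deriv h (of_real x * z))) has_integral Re (h z)) {0..1}"
proof -
  let ?g = "\<lambda>x. x powr s * Re (h (of_real x * z))"
  let ?g' = "\<lambda>x. x powr (s - 1) * Re (of_real s * h (of_real x * z)
            + of_real x * z * deriv h (of_real x * z))"
  have "(?g' has_integral (?g 1 - ?g 0)) {0..1}"
  proof (rule fundamental_theorem_of_calculus_interior)
    show "continuous_on {0..1} ?g"
      by (intro continuous_on_mult continuous_on_powr_unit s continuous_on_Re continuous_on_radial[OF h z])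
    fix x :: real assume x: "x \<in> {0<..<1}"
    note [derivative_intros] = has_real_derivative_Re_radial[OF h z x]
    then have "(?g has_real_derivative s * x powr (s - 1) * Re (h (of_real x * z))
        + x powr s * Re (z * deriv h (of_real x * z))) (at x)"
      using x by (auto intro!: derivative_eq_intros)
    also have "x powr s = x powr (s - 1) * x"
      using x by (simp add: powr_mult_base mult.commute)
    also have "s * x powr (s - 1) * Re (h (of_real x * z))
        + x powr (s - 1) * x * Re (z * deriv h (of_real x * z)) = ?g' x"
      by (simp add: algebra_simps)
    finally show "(?g has_vector_derivative ?g' x) (at x)"
      by (simp add: has_real_derivative_iff_has_vector_derivative)
  qed simp
  then show ?thesis using s by simp
qed

lemma has_integral_xi0_affine:
  assumes "s > 0"
  shows "((\<lambda>x. x powr (s - 1) * (s * (a + b * ((1 - x) / (1 + x))))) has_integral a + b * xi0 s) {0..1}"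
proof -
  have "((\<lambda>x. a * (s * x powr (s - 1)) + b * ((1 - x) / (1 + x) * s * x powr (s - 1)))
          has_integral a * 1 + b * xi0 s) {0..1}"
    by (intro has_integral_add has_integral_mult_right has_integral_powr_weight has_integral_xi0 assms)
  then show ?thesis by (simp add: algebra_simps)
qed

text \<open>
  The sharp lower bound on \<open>Re h\<close>. Since \<open>|xz| \<le> x\<close>, Harnack's bound at \<open>xz\<close> is at least its value at
  modulus \<open>x\<close>, and the mean of the latter is expressed by \<open>\<xi>\<^sub>0\<close>.
\<close>

lemma Re_quotient_ge:
  assumes h: "h holomorphic_on ball 0 1" and h0: "h 0 = 1" and s: "s \<ge> 0" and t: "t < 1"
    and ge: "\<And>z. norm z < 1 \<Longrightarrow> Re (of_real s * h z + z * deriv h z) \<ge> s * t"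
    and z: "norm z < 1"
  shows "Re (h z) \<ge> t + (1 - t) * xi0 s"
proof (cases "s = 0")
  case False
  then have s: "s > 0" using s by simp
  define p where "p = (\<lambda>z. (of_real s * h z + z * deriv h z) / of_real s)"
  have Rep: "Re (p u) = Re (of_real s * h u + u * deriv h u) / s" for u
    unfolding p_def Re_divide_of_real ..
  have harnack: "Re (p u) \<ge> t + (1 - t) * ((1 - norm u) / (1 + norm u))" if "norm u < 1" for u
  proof (rule Harnack_of_Re_ge[OF _ _ t _ that])
    show "p holomorphic_on ball 0 1"
      unfolding p_def using s h by (intro holomorphic_intros) auto
    show "p 0 = 1" using s h0 by (simp add: p_def)
    show "t \<le> Re (p v)" if "norm v < 1" for v
      using ge[OF that] s unfolding Rep by (simp add: field_simps)
  qed
  show ?thesis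
  proof (rule has_integral_le[OF has_integral_xi0_affine[OF s] has_integral_radial[OF h s z]])
    fix x :: real assume x: "x \<in> {0..1}"
    let ?u = "of_real x * z"
    have nu: "norm ?u = x * norm z" using x by (simp add: norm_mult)
    have xz: "x * norm z \<le> x" using x z by (simp add: mult_left_le)
    have u1: "norm ?u < 1" using norm_radial_less_1[OF z x] .
    have "(1 - x) / (1 + x) \<le> (1 - norm ?u) / (1 + norm ?u)"
      unfolding nu using x xz by (intro frac_le) (auto intro: add_pos_nonneg)
    then have "t + (1 - t) * ((1 - x) / (1 + x)) \<le> Re (p ?u)"
      using harnack[OF u1] t by (smt (verit) mult_left_mono)
    then have "s * (t + (1 - t) * ((1 - x) / (1 + x))) \<le> Re (of_real s * h ?u + ?u * deriv h ?u)"
      unfolding Rep using s by (simp add: field_simps)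
    then show "x powr (s - 1) * (s * (t + (1 - t) * ((1 - x) / (1 + x))))
        \<le> x powr (s - 1) * Re (of_real s * h ?u + ?u * deriv h ?u)"
      by (intro mult_left_mono) auto
  qed
next
  case True
  have "Re (h (of_real 0 * z)) \<le> Re (h (of_real 1 * z))"
  proof (rule DERIV_nonneg_imp_increasing_open[where f = "\<lambda>x. Re (h (of_real x * z))"])
    show "continuous_on {0..1} (\<lambda>x. Re (h (of_real x * z)))"
      by (intro continuous_intros continuous_on_radial h z)
    fix x :: real assume x: "0 < x" "x < 1"
    have "((\<lambda>x. Re (h (of_real x * z))) has_real_derivative Re (z * deriv h (of_real x * z))) (at x)"
      using has_real_derivative_Re_radial[OF h z] x by simp
    moreover have "x * Re (z * deriv h (of_real x * z)) \<ge> 0"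
      using ge[OF norm_radial_less_1[OF z], of x] x True by (simp add: algebra_simps)
    then have "Re (z * deriv h (of_real x * z)) \<ge> 0" using x by (simp add: zero_le_mult_iff)
    ultimately show "\<exists>y. ((\<lambda>x. Re (h (of_real x * z))) has_real_derivative y) (at x) \<and> 0 \<le> y"
      by blast
  qed simp
  then show ?thesis using True h0 by (simp add: xi0_def)
qed

text \<open>
  Here \<open>s\<^sub>2 h + z h'\<close> is split into \<open>(s\<^sub>2 - s\<^sub>1) h\<close> and \<open>s\<^sub>1 h + z h'\<close>, and each part has its own bound.
\<close>

lemma frakA_subset_frakA:
  assumes s1: "0 \<le> s1" and t1: "t1 < 1" and s2: "s1 < s2"
  shows "frakA s1 t1 \<subseteq> frakA s2 (t1 + (1 - t1) * (1 - s1 / s2) * xi0 s1)"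
proof
  fix f assume f: "f \<in> frakA s1 t1"
  obtain h where h: "h holomorphic_on ball 0 1" "h 0 = 1"
    and fh: "\<And>z. norm z < 1 \<Longrightarrow> f z = z * h z"
    using frakA_quotient[OF f] by blast
  have ge: "Re (of_real s1 * h z + z * deriv h z) \<ge> s1 * t1" if "norm z < 1" for z
  proof (cases "z = 0")
    case True
    have "s1 * t1 \<le> s1 * 1" using s1 t1 by (intro mult_left_mono) auto
    then show ?thesis using True h(2) by simp
  qed (use f frakA_mult_iff[OF h fh, of s1 t1] that in auto)
  show "f \<in> frakA s2 (t1 + (1 - t1) * (1 - s1 / s2) * xi0 s1)"
  proof (subst frakA_mult_iff[OF h fh], assumption, rule ballI)
    fix z :: complex assume "z \<in> ball 0 1 - {0}"
    then have z: "norm z < 1" by simp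
    have "s2 * (t1 + (1 - t1) * (1 - s1 / s2) * xi0 s1)
        = (s2 - s1) * (t1 + (1 - t1) * xi0 s1) + s1 * t1"
      using s1 s2 by (simp add: field_simps)
    also have "\<dots> \<le> (s2 - s1) * Re (h z) + Re (of_real s1 * h z + z * deriv h z)"
      using Re_quotient_ge[OF h s1 t1 ge z] ge[OF z] s2
      by (intro add_mono mult_left_mono) auto
    also have "\<dots> = Re (of_real s2 * h z + z * deriv h z)"
      by (simp add: algebra_simps)
    finally show "s2 * (t1 + (1 - t1) * (1 - s1 / s2) * xi0 s1)
        \<le> Re (of_real s2 * h z + z * deriv h z)" .
  qed
qed

section \<open>The extremal function\<close>

text \<open>
  The operator \<open>h \<mapsto> s h + z h'\<close> multiplies the \<open>n\<close>-th Taylor coefficient by \<open>s + n\<close>, so the equation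
  is solved by dividing the coefficients \<open>s a\<^sub>n\<close> of the right-hand side by \<open>s + n\<close>. The \<open>a\<^sub>n\<close> come from
  \<open>t + (1 - t) (1 - z) / (1 + z) = (2 t - 1) + 2 (1 - t) / (1 + z)\<close>.
\<close>

lemma extremal_quotient_exists:
  fixes s t :: real
  assumes s: "s > 0"
  obtains h where "h holomorphic_on ball 0 1" "h 0 = 1"
    "\<And>z. norm z < 1 \<Longrightarrow> of_real s * h z + z * deriv h z
        = of_real s * (of_real t + of_real (1 - t) * ((1 - z) / (1 + z)))"
proof -
  define a :: "nat \<Rightarrow> complex" where
    "a = (\<lambda>n. of_real (2 * (1 - t)) * (-1) ^ n + (if n = 0 then of_real (2 * t - 1) else 0))"
  define c where "c = (\<lambda>n. of_real s * a n / (of_real s + of_nat n))"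
  define h where "h = (\<lambda>z. \<Sum>n. c n * z ^ n)"
  have nz: "of_real s + of_nat n \<noteq> (0 :: complex)" for n
    using s by (auto simp: complex_eq_iff)
  have a_sums: "(\<lambda>n. a n * z ^ n) sums (of_real t + of_real (1 - t) * ((1 - z) / (1 + z)))"
    if z: "norm z < 1" for z
  proof -
    have "(\<lambda>n. of_real (2 * (1 - t)) * (- z) ^ n) sums (of_real (2 * (1 - t)) * (1 / (1 - (- z))))"
      using z by (intro sums_mult geometric_sums) simp
    moreover have "(\<lambda>n. if n = 0 then of_real (2 * t - 1) * z ^ n else 0) sums (of_real (2 * t - 1) * z ^ 0)"
      using sums_single[of 0 "\<lambda>n. of_real (2 * t - 1) * z ^ n"] by simp
    ultimately have "(\<lambda>n. of_real (2 * (1 - t)) * (- z) ^ n + (if n = 0 then of_real (2 * t - 1) * z ^ n else 0))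
      sums (of_real (2 * (1 - t)) * (1 / (1 - (- z))) + of_real (2 * t - 1) * z ^ 0)"
      by (rule sums_add)
    moreover have "1 + z \<noteq> 0" using z by (auto simp: add_eq_0_iff)
    then have "of_real (2 * (1 - t)) * (1 / (1 - (- z))) + of_real (2 * t - 1) * z ^ 0
        = of_real t + of_real (1 - t) * ((1 - z) / (1 + z))"
      by (simp add: field_simps)
    moreover have "(\<lambda>n. of_real (2 * (1 - t)) * (- z) ^ n + (if n = 0 then of_real (2 * t - 1) * z ^ n else 0))
        = (\<lambda>n. a n * z ^ n)"
      by (auto simp: a_def fun_eq_iff algebra_simps power_minus[of z])
    ultimately show ?thesis by (simp only:)
  qed
  have c_summable: "summable (\<lambda>n. c n * z ^ n)" if z: "norm z < 1" for z
  proof (rule summable_comparison_test_ev)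
    have a_le: "norm (a n) \<le> \<bar>2 * (1 - t)\<bar> + \<bar>2 * t - 1\<bar>" for n
      unfolding a_def by (rule norm_triangle_le) (auto simp: norm_mult norm_power simp del: of_real_mult of_real_diff)
    show "\<forall>\<^sub>F n in sequentially. norm (c n * z ^ n) \<le> (\<bar>2 * (1 - t)\<bar> + \<bar>2 * t - 1\<bar>) * norm z ^ n"
    proof (intro always_eventually allI)
      fix n
      have "norm (complex_of_real s + of_nat n) = s + n"
        using s norm_of_real[of "s + n", where 'a = complex] by simp
      then have "norm (c n) = norm (a n) * (s / (s + n))"
        using s by (simp add: c_def norm_divide norm_mult)
      also have "\<dots> \<le> norm (a n) * 1"
        using s by (intro mult_left_mono) auto
      finally have "norm (c n) \<le> \<bar>2 * (1 - t)\<bar> + \<bar>2 * t - 1\<bar>" using a_le[of n] by simp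
      then show "norm (c n * z ^ n) \<le> (\<bar>2 * (1 - t)\<bar> + \<bar>2 * t - 1\<bar>) * norm z ^ n"
        by (auto simp: norm_mult norm_power intro!: mult_right_mono)
    qed
    show "summable (\<lambda>n. (\<bar>2 * (1 - t)\<bar> + \<bar>2 * t - 1\<bar>) * norm z ^ n)"
      using z by (intro summable_mult summable_geometric) simp
  qed
  have h_deriv: "(h has_field_derivative (\<Sum>n. diffs c n * z ^ n)) (at z)"
    and d_summable: "summable (\<lambda>n. diffs c n * z ^ n)" if z: "norm z < 1" for z
  proof -
    define K where "K = complex_of_real ((1 + norm z) / 2)"
    have "norm K = (1 + norm z) / 2"
      unfolding K_def norm_of_real by simp
    then have K: "norm K < 1" "norm z < norm K" using z by auto
    show "(h has_field_derivative (\<Sum>n. diffs c n * z ^ n)) (at z)"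
      unfolding h_def by (rule termdiffs_strong[OF c_summable[OF K(1)] K(2)])
    show "summable (\<lambda>n. diffs c n * z ^ n)"
      by (rule termdiff_converges[where K = 1]) (use z c_summable in auto)
  qed
  have ode: "of_real s * h z + z * deriv h z
      = of_real s * (of_real t + of_real (1 - t) * ((1 - z) / (1 + z)))" if z: "norm z < 1" for z
  proof -
    have "(\<lambda>n. of_nat n * c n * z ^ (n - Suc 0)) sums deriv h z"
      using diffs_equiv[OF d_summable[OF z]] DERIV_imp_deriv[OF h_deriv[OF z]] by simp
    then have "(\<lambda>n. z * (of_nat n * c n * z ^ (n - Suc 0))) sums (z * deriv h z)"
      by (rule sums_mult)
    moreover have "z * (of_nat n * c n * z ^ (n - Suc 0)) = of_nat n * c n * z ^ n" for n
      by (cases n) auto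
    ultimately have "(\<lambda>n. of_nat n * c n * z ^ n) sums (z * deriv h z)" by simp
    moreover have "(\<lambda>n. of_real s * (c n * z ^ n)) sums (of_real s * h z)"
      unfolding h_def using c_summable[OF z] by (intro sums_mult summable_sums)
    ultimately have "(\<lambda>n. of_real s * (c n * z ^ n) + of_nat n * c n * z ^ n)
        sums (of_real s * h z + z * deriv h z)" by (rule sums_add[rotated])
    moreover have "of_real s * (c n * z ^ n) + of_nat n * c n * z ^ n = of_real s * (a n * z ^ n)" for n
    proof -
      have "of_real s * (c n * z ^ n) + of_nat n * c n * z ^ n = ((of_real s + of_nat n) * c n) * z ^ n"
        by (simp add: algebra_simps)
      also have "(of_real s + of_nat n) * c n = of_real s * a n" using nz[of n] by (simp add: c_def)
      finally show ?thesis by simp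
    qed
    ultimately have "(\<lambda>n. of_real s * (a n * z ^ n)) sums (of_real s * h z + z * deriv h z)" by simp
    then show ?thesis using sums_mult[OF a_sums[OF z], of "of_real s"] by (rule sums_unique2)
  qed
  show thesis
  proof (rule that)
    show "h holomorphic_on ball 0 1" using h_deriv unfolding holomorphic_on_open[OF open_ball] by (metis mem_ball_0)
    show "h 0 = 1" using ode[of 0] s by simp
  qed (use ode in auto)
qed

text \<open>
  The extremal function is tested at the real points \<open>r \<rightarrow> 1\<close>. There the mean of \<open>(1 - xr) / (1 + xr)\<close>
  exceeds \<open>\<xi>\<^sub>0(s\<^sub>1)\<close> by at most \<open>2 (1 - r)\<close>, since the integrands differ by at most that much for every \<open>x\<close>.
\<close>

lemma frakA_inclusion_bound:
  assumes s1: "0 < s1" and t1: "t1 < 1" and s2: "s1 < s2"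
    and sub: "frakA s1 t1 \<subseteq> frakA s2 t"
  shows "t \<le> t1 + (1 - t1) * (1 - s1 / s2) * xi0 s1"
proof -
  obtain h where h: "h holomorphic_on ball 0 1" "h 0 = 1"
    and ode: "\<And>z. norm z < 1 \<Longrightarrow> of_real s1 * h z + z * deriv h z
        = of_real s1 * (of_real t1 + of_real (1 - t1) * ((1 - z) / (1 + z)))"
    using extremal_quotient_exists[OF s1, of t1] by blast
  have Re_complex_of_real_mult: "Re (of_real a * u) = a * Re u" for a u
    by simp
  have Re_ode: "Re (of_real s1 * h z + z * deriv h z) = s1 * (t1 + (1 - t1) * Re ((1 - z) / (1 + z)))"
    if "norm z < 1" for z
    unfolding ode[OF that] Re_complex_of_real_mult plus_complex.sel Re_complex_of_real by simp
  have Re_ode_real: "Re (of_real s1 * h (of_real x) + of_real x * deriv h (of_real x))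
      = s1 * (t1 + (1 - t1) * ((1 - x) / (1 + x)))" if "0 \<le> x" "x < 1" for x
  proof -
    have "(1 - complex_of_real x) / (1 + of_real x) = of_real ((1 - x) / (1 + x))" by simp
    then have "Re ((1 - complex_of_real x) / (1 + of_real x)) = (1 - x) / (1 + x)"
      by (simp only: Re_complex_of_real)
    then show ?thesis using Re_ode[of "of_real x"] that by simp
  qed
  have "(\<lambda>z. z * h z) \<in> frakA s1 t1"
  proof (subst frakA_mult_iff[OF h refl], rule ballI)
    fix z :: complex assume "z \<in> ball 0 1 - {0}"
    then have z: "norm z < 1" by simp
    have "Re ((1 - z) / (1 + z)) \<ge> 0"
    proof -
      have "(Re z)\<^sup>2 + (Im z)\<^sup>2 \<le> 1"
        using z by (simp flip: cmod_power2 add: power_le_one)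
      then have "0 \<le> Re (1 - z) * Re (1 + z) + Im (1 - z) * Im (1 + z)"
        by (simp add: power2_eq_square algebra_simps)
      then show ?thesis unfolding Re_divide
        by (rule divide_nonneg_nonneg) (intro add_nonneg_nonneg zero_le_power2)
    qed
    then have "s1 * (t1 + 0) \<le> s1 * (t1 + (1 - t1) * Re ((1 - z) / (1 + z)))"
      using s1 t1 by (intro mult_left_mono add_left_mono mult_nonneg_nonneg) auto
    then show "s1 * t1 \<le> Re (of_real s1 * h z + z * deriv h z)"
      using Re_ode[OF z] by simp
  qed
  then have mem: "(\<lambda>z. z * h z) \<in> frakA s2 t" using sub by blast
  have h_le: "Re (h (of_real r)) \<le> t1 + (1 - t1) * (2 * (1 - r)) + (1 - t1) * xi0 s1"
    if r: "0 < r" "r < 1" for r :: real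
  proof (rule has_integral_le[OF has_integral_radial[OF h(1) s1] has_integral_xi0_affine[OF s1]])
    fix x :: real assume x: "x \<in> {0..1}"
    have "x * r \<le> r" using x r by (simp add: mult_left_le_one_le)
    then have xr: "0 \<le> x * r" "x * r < 1" using x r by (simp, linarith)
    have "1 * x \<le> (1 + x * r) * (1 + x)" using x xr by (intro mult_mono) auto
    then have le_1: "x / ((1 + x * r) * (1 + x)) \<le> 1" using x xr by (simp add: divide_le_eq)
    have "(1 - x * r) / (1 + x * r) - (1 - x) / (1 + x) = 2 * (1 - r) * (x / ((1 + x * r) * (1 + x)))"
      using x xr by (simp add: divide_simps) (simp add: algebra_simps)
    also have "\<dots> \<le> 2 * (1 - r)"
      by (rule mult_left_le[OF le_1]) (use r in simp)
    finally have "(1 - x * r) / (1 + x * r) \<le> 2 * (1 - r) + (1 - x) / (1 + x)" by simp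
    then have "(1 - t1) * ((1 - x * r) / (1 + x * r)) \<le> (1 - t1) * (2 * (1 - r) + (1 - x) / (1 + x))"
      using t1 by (intro mult_left_mono) auto
    then have "Re (of_real s1 * h (of_real (x * r)) + of_real (x * r) * deriv h (of_real (x * r)))
      \<le> s1 * (t1 + (1 - t1) * (2 * (1 - r)) + (1 - t1) * ((1 - x) / (1 + x)))"
      unfolding Re_ode_real[OF xr(1,2)] using s1
      by (intro mult_left_mono) (auto simp: distrib_left)
    then show "x powr (s1 - 1) * Re (of_real s1 * h (of_real x * of_real r)
            + of_real x * of_real r * deriv h (of_real x * of_real r))
        \<le> x powr (s1 - 1) * (s1 * (t1 + (1 - t1) * (2 * (1 - r)) + (1 - t1) * ((1 - x) / (1 + x))))"
      by (intro mult_left_mono) auto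
  qed (use r in auto)
  have bound: "s2 * t \<le> (s2 - s1) * (t1 + (1 - t1) * (2 * (1 - r)) + (1 - t1) * xi0 s1)
      + s1 * (t1 + (1 - t1) * ((1 - r) / (1 + r)))" if r: "0 < r" "r < 1" for r :: real
  proof -
    have "s2 * t \<le> Re (of_real s2 * h (of_real r) + of_real r * deriv h (of_real r))"
      by (rule bspec[OF mem[unfolded frakA_mult_iff[OF h refl]]]) (use r in simp)
    also have "\<dots> = (s2 - s1) * Re (h (of_real r)) + Re (of_real s1 * h (of_real r) + of_real r * deriv h (of_real r))"
      by (simp add: algebra_simps)
    also have "\<dots> \<le> (s2 - s1) * (t1 + (1 - t1) * (2 * (1 - r)) + (1 - t1) * xi0 s1)
      + s1 * (t1 + (1 - t1) * ((1 - r) / (1 + r)))"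
      using h_le[OF r] Re_ode_real[of r] r s2 by (intro add_mono mult_left_mono) auto
    finally show ?thesis .
  qed
  have "((\<lambda>r. (s2 - s1) * (t1 + (1 - t1) * (2 * (1 - r)) + (1 - t1) * xi0 s1)
      + s1 * (t1 + (1 - t1) * ((1 - r) / (1 + r)))) \<longlongrightarrow>
      (s2 - s1) * (t1 + (1 - t1) * (2 * (1 - 1)) + (1 - t1) * xi0 s1)
      + s1 * (t1 + (1 - t1) * ((1 - 1) / (1 + 1)))) (at_left 1)"
    by (intro tendsto_intros) auto
  moreover have "\<forall>\<^sub>F r in at_left 1. s2 * t \<le> (s2 - s1) * (t1 + (1 - t1) * (2 * (1 - r)) + (1 - t1) * xi0 s1)
      + s1 * (t1 + (1 - t1) * ((1 - r) / (1 + r)))"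
    by (rule eventually_at_leftI[of 0]) (use bound in simp_all)
  ultimately have "s2 * t \<le> (s2 - s1) * (t1 + (1 - t1) * (2 * (1 - 1)) + (1 - t1) * xi0 s1)
      + s1 * (t1 + (1 - t1) * ((1 - 1) / (1 + 1)))"
    by (rule tendsto_lowerbound) (simp add: trivial_limit_at_left_real)
  also have "\<dots> = s2 * (t1 + (1 - t1) * (1 - s1 / s2) * xi0 s1)"
    using s1 s2 by (simp add: field_simps)
  finally show ?thesis using s1 s2 by simp
qed

section \<open>Composing two inclusions\<close>

text \<open>
  Passing through an intermediate class loses strictly. In terms of \<open>1 - t\<close> both sides are products,
  and the difference of the factors is a positive multiple of the difference in
  \<open>xi0_ratio_strict_decreasing\<close>.
\<close>

lemma sharp_constant_compose_less:
  assumes s: "0 < s0" "s0 < s1" "s1 < s2" and t0: "t0 < 1"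
    and t1: "t1 \<le> t0 + (1 - t0) * (1 - s0 / s1) * xi0 s0"
  shows "t1 + (1 - t1) * (1 - s1 / s2) * xi0 s1 < t0 + (1 - t0) * (1 - s0 / s2) * xi0 s0"
proof -
  define X Y where "X = xi0 s0" and "Y = xi0 s1"
  have ratio: "s1 * Y * (1 - X) < s0 * X * (1 - Y)"
    using xi0_ratio_strict_decreasing[OF s(1,2)] by (simp add: X_def Y_def)
  have Y: "Y \<le> 1" using xi0_le_1[of s1] s by (simp add: Y_def)
  have "(1 - s1 / s2) * Y \<le> 1"
  proof -
    have "(1 - s1 / s2) * Y \<le> (1 - s1 / s2) * 1" using s Y by (intro mult_left_mono) auto
    also have "\<dots> \<le> 1" using s by simp
    finally show ?thesis .
  qed
  then have "(1 - t0) * (1 - (1 - s0 / s1) * X) * (1 - (1 - s1 / s2) * Y)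
      \<le> (1 - t1) * (1 - (1 - s1 / s2) * Y)"
    using t1 by (intro mult_right_mono) (auto simp: X_def algebra_simps)
  moreover have "(1 - t0) * (1 - (1 - s0 / s2) * X)
      < (1 - t0) * ((1 - (1 - s0 / s1) * X) * (1 - (1 - s1 / s2) * Y))"
  proof (intro mult_strict_left_mono)
    have "(1 - (1 - s0 / s1) * X) * (1 - (1 - s1 / s2) * Y) - (1 - (1 - s0 / s2) * X)
       = (1 - s1 / s2) / s1 * (s0 * X * (1 - Y) - s1 * Y * (1 - X))"
      using s by (simp add: divide_simps) (simp add: algebra_simps)
    also have "\<dots> > 0" using s ratio by (intro mult_pos_pos divide_pos_pos) auto
    finally show "1 - (1 - s0 / s2) * X < (1 - (1 - s0 / s1) * X) * (1 - (1 - s1 / s2) * Y)"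
      by simp
  qed (use t0 in auto)
  ultimately have "(1 - t0) * (1 - (1 - s0 / s2) * X) < (1 - t1) * (1 - (1 - s1 / s2) * Y)"
    by (simp add: mult.assoc)
  then show ?thesis by (simp add: X_def Y_def algebra_simps)
qed

lemma sharp_constant_le_1:
  assumes "0 \<le> s1" "s1 < s2" "t1 < 1"
  shows "t1 + (1 - t1) * (1 - s1 / s2) * xi0 s1 \<le> 1"
    and "(1 - t1) * s1 \<le> (1 - (t1 + (1 - t1) * (1 - s1 / s2) * xi0 s1)) * s2"
proof -
  have "(1 - t1) * (1 - s1 / s2) * xi0 s1 \<le> (1 - t1) * (1 - s1 / s2) * 1"
    using assms xi0_le_1[of s1] by (intro mult_left_mono mult_nonneg_nonneg) auto
  then have *: "(1 - t1) * (s1 / s2) \<le> 1 - (t1 + (1 - t1) * (1 - s1 / s2) * xi0 s1)"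
    by (simp add: algebra_simps)
  moreover have "0 \<le> (1 - t1) * (s1 / s2)" using assms by simp
  ultimately show "t1 + (1 - t1) * (1 - s1 / s2) * xi0 s1 \<le> 1" by linarith
  show "(1 - t1) * s1 \<le> (1 - (t1 + (1 - t1) * (1 - s1 / s2) * xi0 s1)) * s2"
    using mult_right_mono[OF *, of s2] assms by simp
qed

theorem theorem3p3:
  fixes s1 t1 s2 :: real
  assumes "0 \<le> s1" and "0 \<le> t1" and "t1 < 1" and "s1 < s2"
  shows
    "(\<forall>t2::real. t2 = t1 + (1 - t1) * (1 - s1 / s2) * xi0 s1 \<longrightarrow>
        frakA s1 t1 \<subseteq> frakA s2 t2 \<and>
        (\<forall>t \<in> {t2<..1}. \<not> frakA s1 t1 \<subseteq> frakA s2 t))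
     \<and>
     (\<forall>t2::real. t2 \<in> {0..1} \<longrightarrow> frakA s1 t1 \<subseteq> frakA s2 t2 \<longrightarrow>
        t2 \<le> t1 + (1 - t1) * (1 - s1 / s2) * xi0 s1 \<and>
        (1 - t2) * s2 \<ge> (1 - t1) * s1)
     \<and>
     (\<forall>s0 t0 t2 :: real. s0 \<in> {0..<s1} \<longrightarrow> t0 \<in> {0..<1} \<longrightarrow> t2 \<in> {0..<1} \<longrightarrow>
        frakA s0 t0 \<subseteq> frakA s1 t1 \<longrightarrow> frakA s1 t1 \<subseteq> frakA s2 t2 \<longrightarrow>
        (\<exists>t \<in> {t2<..1}. frakA s0 t0 \<subseteq> frakA s2 t))"
proof -
  \<comment> \<open>At \<open>s1 = 0\<close> the right-hand side is \<open>1\<close>.\<close>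
  have bound: "t \<le> t1 + (1 - t1) * (1 - s1 / s2) * xi0 s1"
    if "frakA s1 t1 \<subseteq> frakA s2 t" "t \<le> 1" for t
  proof (cases "s1 = 0")
    case True
    then show ?thesis using that by (simp add: xi0_def)
  next
    case False
    then show ?thesis using frakA_inclusion_bound[OF _ assms(3,4) that(1)] assms(1) by simp
  qed
  show ?thesis
  proof (intro conjI allI impI ballI)
    fix t2 assume "t2 = t1 + (1 - t1) * (1 - s1 / s2) * xi0 s1"
    then show "frakA s1 t1 \<subseteq> frakA s2 t2"
      using frakA_subset_frakA[OF assms(1,3,4)] by simp
  next
    fix t2 t assume "t2 = t1 + (1 - t1) * (1 - s1 / s2) * xi0 s1" "t \<in> {t2<..1}"
    then show "\<not> frakA s1 t1 \<subseteq> frakA s2 t" using bound[of t] by auto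
  next
    fix t2 :: real assume "t2 \<in> {0..1}" "frakA s1 t1 \<subseteq> frakA s2 t2"
    then show le: "t2 \<le> t1 + (1 - t1) * (1 - s1 / s2) * xi0 s1" using bound by auto
    have "(1 - (t1 + (1 - t1) * (1 - s1 / s2) * xi0 s1)) * s2 \<le> (1 - t2) * s2"
      using le assms by (intro mult_right_mono) auto
    then show "(1 - t1) * s1 \<le> (1 - t2) * s2"
      using sharp_constant_le_1(2)[OF assms(1,4,3)] by linarith
  next
    fix s0 t0 t2 :: real
    assume s0: "s0 \<in> {0..<s1}" and t0: "t0 \<in> {0..<1}" and t2: "t2 \<in> {0..<1}"
      and sub01: "frakA s0 t0 \<subseteq> frakA s1 t1" and sub12: "frakA s1 t1 \<subseteq> frakA s2 t2"
    define T where "T = t0 + (1 - t0) * (1 - s0 / s2) * xi0 s0"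
    have "t2 < T"
    proof (cases "s0 = 0")
      case True
      then show ?thesis using t2 by (simp add: T_def xi0_def)
    next
      case False
      have "t1 \<le> t0 + (1 - t0) * (1 - s0 / s1) * xi0 s0"
        using False s0 t0 by (intro frakA_inclusion_bound sub01) auto
      then have "t1 + (1 - t1) * (1 - s1 / s2) * xi0 s1 < T"
        unfolding T_def using False s0 t0 assms by (intro sharp_constant_compose_less) auto
      then show ?thesis using bound[OF sub12] t2 by simp
    qed
    moreover have "T \<le> 1"
      unfolding T_def using s0 t0 assms by (intro sharp_constant_le_1(1)) auto
    moreover have "frakA s0 t0 \<subseteq> frakA s2 T"
      unfolding T_def using s0 t0 assms by (intro frakA_subset_frakA) auto
    ultimately show "\<exists>t \<in> {t2<..1}. frakA s0 t0 \<subseteq> frakA s2 t" by auto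
  qed
qed

end
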